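(* Let $\mathbb{F}$ be a field and let $V$ be an infinite-dimensional vector space over $\mathbb{F}$. Then every automorphism of $V$ is the product of four involutions of $V$, i.e. for every $u \in \mathrm{GL}(V)$ there exist $a_1,a_2,a_3,a_4 \in \mathrm{End}(V)$ with $a_i^2=\mathrm{id}_V$ for all $i\in\{1,2,3,4\}$ and $u=a_1a_2a_3a_4$.
   Context: $\mathrm{End}(V)$ is the algebra of all $\mathbb{F}$-linear endomorphisms of $V$, and $\mathrm{GL}(V)$ is its group of units (the automorphisms of $V$). An involution is an element $a$ with $a^2=\mathrm{id}_V$ (the identity is allowed). *)

theory Defs
  imports Complex_Main
begin

text \<open>The vector space \<open>V\<close> is the whole type \<open>'b\<close>, with scalar multiplication \<open>scale\<close> over the
  field \<open>'a\<close>. The library's \<open>dim\<close> is a natural number, equal to 0 when there is no finite basis,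
  so infinite dimension is expressed through bases.\<close>

definition infinite_dimensional ::
    "('a::field \<Rightarrow> 'b::ab_group_add \<Rightarrow> 'b) \<Rightarrow> bool" where
  "infinite_dimensional scale \<longleftrightarrow>
     \<not> (\<exists>B. finite B \<and> \<not> module.dependent scale B \<and> module.span scale B = UNIV)"

definition End ::
    "('a::field \<Rightarrow> 'b::ab_group_add \<Rightarrow> 'b) \<Rightarrow> ('b \<Rightarrow> 'b) set" where
  "End scale = {f. Vector_Spaces.linear scale scale f}"

definition GL ::
    "('a::field \<Rightarrow> 'b::ab_group_add \<Rightarrow> 'b) \<Rightarrow> ('b \<Rightarrow> 'b) set" where
  "GL scale = {u \<in> End scale. \<exists>v \<in> End scale. u \<circ> v = id \<and> v \<circ> u = id}"

text \<open>The identity counts as an involution.\<close>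

definition involution ::
    "('a::field \<Rightarrow> 'b::ab_group_add \<Rightarrow> 'b) \<Rightarrow> ('b \<Rightarrow> 'b) \<Rightarrow> bool" where
  "involution scale a \<longleftrightarrow> a \<in> End scale \<and> a \<circ> a = id"

end

theory Submission
  imports Defs
begin

text \<open>Index a basis of \<open>V\<close> by \<open>L \<times> \<nat>\<close> with a lexicographic well-order, and let \<open>lead v\<close> be the largest
  index in the support of \<open>v\<close>. A Bruhat decomposition of \<open>u\<close> with respect to the flag of this basis
  gives a basis \<open>x\<close> with \<open>lead (x i) = i\<close> and \<open>lead (u (x i)) = \<pi> i\<close> for a permutation \<open>\<pi>\<close> of the indices.
  For any permutation \<open>\<sigma>\<close> we have \<open>u = g h\<close>, where \<open>h\<close> permutes the basis \<open>x\<close> by \<open>\<sigma>\<^sup>-\<^sup>1 \<pi>\<close> and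
  \<open>lead (g (x j)) = \<sigma> j\<close>. Take for \<open>\<sigma>\<close> the zigzag shift \<open>\<dots> \<mapsto> 3 \<mapsto> 1 \<mapsto> 0 \<mapsto> 2 \<mapsto> 4 \<mapsto> \<dots>\<close> on each copy of \<open>\<nat>\<close>.
  Then the vectors \<open>g\<^sup>k (x (l, 0))\<close>, with \<open>k\<close> an integer, have each index exactly once as leading index, so
  they form a basis permuted by \<open>g\<close>. A linear map permuting a basis is a product of two involutions,
  because every permutation is.\<close>

section \<open>Permutations as products of two involutions\<close>

text \<open>Along each orbit the permutation is a translation of a quotient of the integers, hence a product
  of two reflections.\<close>

lemma bij_two_involutions:
  fixes p :: "'i \<Rightarrow> 'i"
  assumes "bij p"
  shows "\<exists>a b. (\<forall>x. a (a x) = x) \<and> (\<forall>x. b (b x) = x) \<and> (\<forall>x. p x = a (b x)) \<and>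
    (\<forall>A. p ` A = A \<longrightarrow> a ` A = A \<and> b ` A = A)"
proof -
  define q where "q = inv p"
  have pq: "p (q x) = x" "q (p x) = x" for x
    using assms by (simp_all add: q_def bij_is_surj surj_f_inv_f bij_is_inj inv_f_f)
  \<comment> \<open>\<open>z\<close> is the action of the integers by powers of
    \<open>p\<close>.\<close>
  define z where "z k = (if 0 \<le> k then p ^^ nat k else q ^^ nat (- k))" for k :: int
  have z0: "z 0 x = x" for x by (simp add: z_def)
  have z_Suc: "z (k + 1) x = p (z k x)" for k x
  proof (cases "0 \<le> k")
    case True
    then have "nat (k + 1) = Suc (nat k)" by simp
    then show ?thesis using True by (simp add: z_def)
  next
    case False
    then have "nat (- k) = Suc (nat (- (k + 1)))" by simp
    then show ?thesis using False by (cases "k = -1") (auto simp: z_def pq)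
  qed
  have z_pred: "z (k - 1) x = q (z k x)" for k x
    using z_Suc[of "k - 1" x] by (simp add: pq)
  have z_add: "z (k + l) x = z k (z l x)" for k l x
  proof (induction k rule: int_induct[where k = 0])
    case base show ?case by (simp add: z0)
  next
    case (step1 i) then show ?case
      using z_Suc[of "i + l" x] z_Suc[of i "z l x"] by (simp add: algebra_simps)
  next
    case (step2 i) then show ?case
      using z_pred[of "i + l" x] z_pred[of i "z l x"] by (simp add: algebra_simps)
  qed
  \<comment> \<open>On a finite orbit exponents are determined only modulo the period. Negation
    respects this ambiguity, so the reflection \<open>a\<close> does not depend on the choice of
    \<open>h\<close>.\<close>
  have z_flip: "z (- k) x = z (- l) x" if "z k x = z l x" for k l x
  proof -
    have "z (- k - l) (z k x) = z (- l) x" "z (- k - l) (z l x) = z (- k) x"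
      by (simp_all flip: z_add)
    then show ?thesis using that by simp
  qed
  define orb where "orb x = range (\<lambda>k. z k x)" for x
  have orb_z: "orb (z k x) = orb x" for k x
  proof -
    have "z l x \<in> orb (z k x)" for l
      unfolding orb_def by (rule range_eqI[of _ _ "l - k"]) (simp flip: z_add)
    then show ?thesis by (auto simp: orb_def simp flip: z_add)
  qed
  \<comment> \<open>The choice sees only the set \<open>orb x\<close>, so all points of an orbit
    share one base point.\<close>
  define r where "r x = (SOME y. y \<in> orb x)" for x
  have "x \<in> orb x" for x unfolding orb_def using z0[of x] by (metis rangeI)
  then have "r x \<in> orb x" for x unfolding r_def by (rule someI)
  then have "\<exists>k. x = z k (r x)" for x
  proof -
    obtain k where "r x = z k x" using \<open>r x \<in> orb x\<close> by (auto simp: orb_def)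
    then have "z (- k) (r x) = x" by (simp add: z0 flip: z_add)
    then show ?thesis by metis
  qed
  then obtain h where h: "x = z (h x) (r x)" for x by metis
  have r_z: "r (z k x) = r x" for k x by (simp add: r_def orb_z)
  define a where "a x = z (- h x) (r x)" for x
  have a_z: "a (z k (r x)) = z (- k) (r x)" for k x
  proof -
    have "r (r x) = r x" using r_z[of "h x" "r x"] h[of x] by simp
    then have "r (z k (r x)) = r x" by (simp add: r_z)
    then show ?thesis unfolding a_def using h[of "z k (r x)"] by (metis z_flip)
  qed
  have aa: "a (a x) = x" for x
    using a_z[of "- h x" x] h[of x] by (simp add: a_def)
  \<comment> \<open>Relative to the base point, \<open>a\<close> after \<open>p\<close> turns
    exponent \<open>k\<close> into \<open>- (k + 1)\<close>, which is again a reflection.\<close>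
  have apap: "a (p (a (p x))) = x" for x
  proof -
    have "p x = z (h x + 1) (r x)" using h[of x] by (simp add: z_Suc)
    then have "p (a (p x)) = z (- h x) (r x)"
      using a_z[of "h x + 1" x] z_Suc[of "- (h x + 1)" "r x"] by simp
    then show ?thesis using a_z[of "- h x" x] h[of x] by simp
  qed
  show ?thesis
  proof (rule exI[of _ a], rule exI[of _ "a \<circ> p"], intro conjI allI impI)
    fix A assume A: "p ` A = A"
    have p_in: "p x \<in> A" if "x \<in> A" for x using A that by blast
    have q_in: "q x \<in> A" if "x \<in> A" for x using A that pq by (metis imageE)
    have z_in: "z k x \<in> A" if "x \<in> A" for k x
      by (induction k rule: int_induct[where k = 0])
         (simp_all add: z0 that z_Suc z_pred p_in q_in)
    have a_in: "a x \<in> A" if "x \<in> A" for x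
    proof -
      have "r x = z (- h x) x" using h[of x] z_add[of "- h x" "h x" "r x"] by (simp add: z0)
      then show ?thesis using that by (simp add: a_def z_in)
    qed
    then show a: "a ` A = A" using aa by (metis image_subset_iff subsetI subset_antisym image_eqI)
    show "(a \<circ> p) ` A = A" using A a by (simp only: image_comp[symmetric])
  qed (simp_all add: aa apap)
qed

text \<open>Extended by the identity outside \<open>A\<close>, \<open>p\<close> becomes a
  permutation of the whole type; the invariance clause of the previous lemma keeps both involutions
  inside \<open>A\<close>.\<close>

lemma bij_betw_two_involutions:
  assumes "bij_betw p A A"
  obtains a b where "\<And>x. x \<in> A \<Longrightarrow> a x \<in> A \<and> a (a x) = x" "\<And>x. x \<in> A \<Longrightarrow> b x \<in> A \<and> b (b x) = x"
    "\<And>x. x \<in> A \<Longrightarrow> p x = a (b x)"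
proof -
  define p' where "p' x = (if x \<in> A then p x else x)" for x
  have A: "bij_betw p' A A"
    using assms by (simp add: p'_def cong: bij_betw_cong)
  moreover have "bij_betw p' (- A) (- A)"
    by (auto simp: p'_def bij_betw_def inj_on_def)
  ultimately have "bij p'"
    using bij_betw_combine[of p' A A "- A" "- A"] by simp
  from bij_two_involutions[OF this] obtain a b where
    ab: "\<forall>x. a (a x) = x" "\<forall>x. b (b x) = x" "\<forall>x. p' x = a (b x)"
      "\<forall>B. p' ` B = B \<longrightarrow> a ` B = B \<and> b ` B = B"
    by (elim exE conjE) (rule that)
  have "p' ` A = A" using A by (simp add: bij_betw_def)
  from ab(4)[rule_format, OF this] have *: "\<And>x. x \<in> A \<Longrightarrow> a x \<in> A" "\<And>x. x \<in> A \<Longrightarrow> b x \<in> A" by auto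
  show ?thesis
  proof (rule that[of a b])
    fix x assume "x \<in> A"
    then show "p x = a (b x)" using ab(3)[rule_format, of x] by (simp add: p'_def)
  qed (simp_all add: ab(1,2) *)
qed

section \<open>Linear maps permuting a basis\<close>

text \<open>A basis is kept as a family, so that permutations of the index set act on it.\<close>

definition indexed_basis :: "('a::field \<Rightarrow> 'b::ab_group_add \<Rightarrow> 'b) \<Rightarrow> ('i \<Rightarrow> 'b) \<Rightarrow> 'i set \<Rightarrow> bool" where
  "indexed_basis scale x I \<longleftrightarrow>
     inj_on x I \<and> \<not> module.dependent scale (x ` I) \<and> module.span scale (x ` I) = UNIV"

lemma linear_eq_on_basis:
  assumes "vector_space scale" "indexed_basis scale x I"
    and "f \<in> End scale" "g \<in> End scale" "\<And>i. i \<in> I \<Longrightarrow> f (x i) = g (x i)"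
  shows "f = g"
proof
  interpret vector_space scale by fact
  interpret vector_space_pair scale scale by unfold_locales
  fix v show "f v = g v"
    by (rule linear_eq_on[where B = "x ` I"]) (use assms in \<open>auto simp: End_def indexed_basis_def\<close>)
qed

lemma linear_extension_exists:
  assumes "vector_space scale" "indexed_basis scale x I"
  obtains f where "f \<in> End scale" "\<And>i. i \<in> I \<Longrightarrow> f (x i) = y i"
proof -
  interpret vector_space scale by fact
  interpret vector_space_pair scale scale by unfold_locales
  obtain f where f: "Vector_Spaces.linear scale scale f" "\<forall>v\<in>x ` I. f v = y (inv_into I x v)"
    using linear_independent_extend[of "x ` I" "\<lambda>v. y (inv_into I x v)"] assms
    by (auto simp: indexed_basis_def)
  then show ?thesis
    using assms by (intro that[of f]) (auto simp: End_def indexed_basis_def)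
qed

lemma End_comp: "f \<in> End scale \<Longrightarrow> g \<in> End scale \<Longrightarrow> f \<circ> g \<in> End scale"
  by (simp add: End_def Vector_Spaces.linear_compose)

lemma End_id: "vector_space scale \<Longrightarrow> id \<in> End scale"
  by (simp add: End_def vector_space.linear_id)

text \<open>Involutions of \<open>I\<close> with composite \<open>p\<close> extend linearly; the
  required identities need checking only on the basis.\<close>

lemma permuted_basis_two_involutions:
  assumes scale: "vector_space scale" and x: "indexed_basis scale x I" and f: "f \<in> End scale"
    and p: "bij_betw p I I" and fx: "\<And>i. i \<in> I \<Longrightarrow> f (x i) = x (p i)"
  obtains f1 f2 where "involution scale f1" "involution scale f2" "f = f1 \<circ> f2"
proof -
  note eq_onI = linear_eq_on_basis[OF scale x]
  have ext: "\<exists>g. involution scale g \<and> (\<forall>i\<in>I. g (x i) = x (a i))"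
    if a: "\<And>i. i \<in> I \<Longrightarrow> a i \<in> I \<and> a (a i) = i" for a
  proof -
    obtain g where g: "g \<in> End scale" "\<And>i. i \<in> I \<Longrightarrow> g (x i) = x (a i)"
      using linear_extension_exists[OF scale x, of "\<lambda>i. x (a i)"] by blast
    then have "g \<circ> g = id"
      by (intro eq_onI) (auto simp: End_comp End_id scale a)
    then show ?thesis using g by (auto simp: involution_def)
  qed
  obtain a b where a: "\<And>i. i \<in> I \<Longrightarrow> a i \<in> I \<and> a (a i) = i"
    and b: "\<And>i. i \<in> I \<Longrightarrow> b i \<in> I \<and> b (b i) = i" and ab: "\<And>i. i \<in> I \<Longrightarrow> p i = a (b i)"
    using bij_betw_two_involutions[OF p] by blast
  obtain f1 where f1: "involution scale f1" "\<forall>i\<in>I. f1 (x i) = x (a i)" using ext[OF a] by blast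
  obtain f2 where f2: "involution scale f2" "\<forall>i\<in>I. f2 (x i) = x (b i)" using ext[OF b] by blast
  have "f = f1 \<circ> f2"
    by (rule eq_onI) (use f f1 f2 b ab fx in \<open>auto simp: involution_def End_comp\<close>)
  then show ?thesis using that f1 f2 by blast
qed

section \<open>Leading indices\<close>

text \<open>This axiomatises the largest index in the support of a vector.
  \<open>lead_cancel\<close> expresses that each step of the flag adds one dimension. The value of
  \<open>lead\<close> at 0 is left open.\<close>

locale leading_index = vector_space scale
  for scale :: "'a::field \<Rightarrow> 'b::ab_group_add \<Rightarrow> 'b" (infixr \<open>*s\<close> 75) +
  fixes less :: "'i \<Rightarrow> 'i \<Rightarrow> bool" (infix \<open>\<prec>\<close> 50)
    and I :: "'i set"
    and lead :: "'b \<Rightarrow> 'i"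
  assumes wf: "wfP (\<prec>)"
    and trans: "i \<prec> j \<Longrightarrow> j \<prec> k \<Longrightarrow> i \<prec> k"
    and total: "i \<noteq> j \<Longrightarrow> i \<prec> j \<or> j \<prec> i"
    and lead_in: "v \<noteq> 0 \<Longrightarrow> lead v \<in> I"
    and lead_onto: "i \<in> I \<Longrightarrow> \<exists>v. v \<noteq> 0 \<and> lead v = i"
    and lead_scale: "v \<noteq> 0 \<Longrightarrow> c \<noteq> 0 \<Longrightarrow> lead (c *s v) = lead v"
    and lead_add: "v \<noteq> 0 \<Longrightarrow> w \<noteq> 0 \<Longrightarrow> lead w \<prec> lead v \<Longrightarrow> v + w \<noteq> 0 \<and> lead (v + w) = lead v"
    and lead_cancel: "v \<noteq> 0 \<Longrightarrow> w \<noteq> 0 \<Longrightarrow> lead v = lead w \<Longrightarrow>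
      \<exists>c. v - c *s w = 0 \<or> lead (v - c *s w) \<prec> lead v"
begin

definition below :: "'i \<Rightarrow> 'b set" where
  "below i = {v. v = 0 \<or> lead v \<prec> i}"

definition adapted :: "('i \<Rightarrow> 'b) \<Rightarrow> bool" where
  "adapted x \<longleftrightarrow> (\<forall>i\<in>I. x i \<noteq> 0 \<and> lead (x i) = i)"

lemma irrefl: "\<not> i \<prec> i"
  using wf by (meson wfp_on_def wfp_imp_irreflp irreflpD)

lemma lead_add_below:
  assumes "v \<noteq> 0" "w \<in> below (lead v)"
  shows "v + w \<noteq> 0" "lead (v + w) = lead v"
  using assms lead_add[of v w] by (cases "w = 0"; auto simp: below_def)+

lemma subspace_below: "subspace (below i)"
proof (rule subspaceI)
  show "0 \<in> below i" by (simp add: below_def)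
next
  fix v w assume v: "v \<in> below i" and w: "w \<in> below i"
  show "v + w \<in> below i"
  \<comment> \<open>If the sum had too large a leading index, this index would exceed that of
    \<open>v\<close>, and \<open>w = (v + w) - v\<close> would inherit it.\<close>
  proof (rule ccontr)
    assume "v + w \<notin> below i"
    then have vw: "v + w \<noteq> 0" "\<not> lead (v + w) \<prec> i" by (auto simp: below_def)
    then have le: "lead (v + w) = i \<or> i \<prec> lead (v + w)" using total by blast
    have "v \<noteq> 0" using vw w by (auto simp: below_def)
    then have "lead v \<prec> lead (v + w)" using v le trans by (auto simp: below_def)
    moreover have "lead (- v) = lead v"
      using lead_scale[of v "-1"] \<open>v \<noteq> 0\<close> by simp
    ultimately have "- v \<in> below (lead (v + w))" by (simp add: below_def)
    from lead_add_below[OF vw(1) this] have "w \<noteq> 0" "lead w = lead (v + w)" by auto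
    then show False using w vw by (simp add: below_def)
  qed
next
  fix c v assume "v \<in> below i"
  then show "c *s v \<in> below i"
    using lead_scale[of v c] by (cases "c = 0"; cases "v = 0") (auto simp: below_def)
qed

lemma lead_split:
  assumes "v \<noteq> 0" "w \<noteq> 0" "lead v = lead w"
  obtains c r where "c \<noteq> 0" "v = c *s w + r" "r \<in> below (lead v)"
proof -
  obtain c where c: "v - c *s w \<in> below (lead v)"
    using lead_cancel[OF assms] by (auto simp: below_def)
  have "c \<noteq> 0" using c assms(1) irrefl by (auto simp: below_def)
  then show ?thesis using c by (intro that[of c "v - c *s w"]) auto
qed

text \<open>Terms with distinct leading indices cannot cancel: at each addition the larger of the
  two indices survives.\<close>

lemma lead_sum:
  assumes "finite S" "S \<noteq> {}" "0 \<notin> S" "inj_on lead S" "\<And>v. v \<in> S \<Longrightarrow> f v \<noteq> 0"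
  shows "(\<Sum>v\<in>S. f v *s v) \<noteq> 0 \<and> lead (\<Sum>v\<in>S. f v *s v) \<in> lead ` S"
  using assms
proof (induction S rule: finite_ne_induct)
  case (singleton x)
  then show ?case by (simp add: lead_scale)
next
  case (insert x S)
  let ?s = "\<Sum>v\<in>S. f v *s v" and ?x = "f x *s x"
  have s: "?s \<noteq> 0" "lead ?s \<in> lead ` S" using insert by auto
  have x: "?x \<noteq> 0" "lead ?x = lead x" using insert.prems by (auto simp: lead_scale)
  have "lead x \<notin> lead ` S" using insert by auto
  then have "lead x \<noteq> lead ?s" using s by metis
  then consider "lead ?x \<prec> lead ?s" | "lead ?s \<prec> lead ?x" using total x by metis
  then have "?x + ?s \<noteq> 0 \<and> lead (?x + ?s) \<in> insert (lead x) (lead ` S)"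
    using lead_add[of ?x ?s] lead_add[of ?s ?x] s x
    by cases (simp_all add: add.commute)
  then show ?case using insert.hyps by simp
qed

lemma lead_in_span:
  assumes "0 \<notin> S" "inj_on lead S" "y \<in> span S" "y \<noteq> 0"
  shows "lead y \<in> lead ` S"
proof -
  obtain f where f: "y = (\<Sum>v | f v \<noteq> 0. f v *s v)" "finite {v. f v \<noteq> 0}" "\<forall>v. f v \<noteq> 0 \<longrightarrow> v \<in> S"
    using assms(3) unfolding span_explicit' by blast
  let ?T = "{v. f v \<noteq> 0}"
  have T: "?T \<subseteq> S" using f by auto
  have ne: "?T \<noteq> {}" using f(1) assms(4) by (metis sum.empty)
  have "0 \<notin> ?T" using T assms(1) by blast
  from lead_sum[OF f(2) ne this inj_on_subset[OF assms(2) T], of f] have "lead y \<in> lead ` ?T"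
    by (simp flip: f(1))
  then show ?thesis using T by blast
qed

lemma independent_if_inj_on_lead:
  assumes "0 \<notin> S" "inj_on lead S"
  shows "independent S"
proof
  assume "dependent S"
  then obtain t f where t: "finite t" "t \<subseteq> S" "(\<Sum>v\<in>t. f v *s v) = 0" "\<exists>v\<in>t. f v \<noteq> 0"
    unfolding dependent_explicit by blast
  let ?T = "{v\<in>t. f v \<noteq> 0}"
  have "(\<Sum>v\<in>?T. f v *s v) = (\<Sum>v\<in>t. f v *s v)"
    by (rule sum.mono_neutral_left) (use t in auto)
  moreover have "(\<Sum>v\<in>?T. f v *s v) \<noteq> 0"
  proof (rule lead_sum[THEN conjunct1])
    have "?T \<subseteq> S" using t(2) by blast
    then show "0 \<notin> ?T" "inj_on lead ?T"
      using assms(1) inj_on_subset[OF assms(2)] by blast+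
  qed (use t(1,4) in auto)
  ultimately show False using t by simp
qed

lemma adapted_basis:
  assumes "adapted x"
  shows "indexed_basis scale x I"
proof -
  have x: "x i \<noteq> 0" "lead (x i) = i" if "i \<in> I" for i
    using assms that by (auto simp: adapted_def)
  \<comment> \<open>Gaussian elimination as well-founded induction: subtracting a multiple of
    \<open>x (lead v)\<close> lowers the leading index.\<close>
  have "v \<in> span (x ` I)" if "v \<noteq> 0" for v
    using that
  proof (induction "lead v" arbitrary: v rule: wfp_induct_rule[OF wf])
    case (1 v)
    have i: "lead v \<in> I" using 1 by (simp add: lead_in)
    obtain c r where r: "v = c *s x (lead v) + r" "r \<in> below (lead v)"
      using lead_split[of v "x (lead v)"] x[OF i] 1(2) by metis
    have "r \<in> span (x ` I)"
    proof (cases "r = 0")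
      case False
      then show ?thesis using 1(1)[of r] r(2) by (auto simp: below_def)
    qed (simp add: span_zero)
    then show ?case
      using r(1) i by (metis imageI span_add span_base span_scale)
  qed
  then have "span (x ` I) = UNIV" by (metis UNIV_eq_I span_zero)
  moreover have "independent (x ` I)"
    by (rule independent_if_inj_on_lead) (use x in \<open>auto simp: inj_on_def\<close>)
  moreover have "inj_on x I" by (metis x(2) inj_onI)
  ultimately show ?thesis by (simp add: indexed_basis_def)
qed

text \<open>All terms of \<open>v\<close> other than the leading one have smaller indices, so it
  suffices that \<open>\<tau>\<close> at \<open>lead v\<close> exceeds its values at all smaller
  indices; \<open>\<tau>\<close> need not be monotone elsewhere.\<close>

lemma lead_image:
  assumes f: "f \<in> End scale" and b: "adapted b"
    and \<tau>: "\<And>k. k \<in> I \<Longrightarrow> f (b k) \<noteq> 0 \<and> lead (f (b k)) = \<tau> k"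
    and v: "v \<noteq> 0" and mono: "\<And>j. j \<in> I \<Longrightarrow> j \<prec> lead v \<Longrightarrow> \<tau> j \<prec> \<tau> (lead v)"
  shows "f v \<noteq> 0 \<and> lead (f v) = \<tau> (lead v)"
proof -
  interpret f: Vector_Spaces.linear scale scale f using f by (simp add: End_def)
  let ?i = "lead v"
  have b': "b k \<noteq> 0" "lead (b k) = k" if "k \<in> I" for k using b that by (auto simp: adapted_def)
  have *: "f w \<in> below (\<tau> ?i)" if "w \<noteq> 0" "lead w \<prec> ?i" for w
    using that
  proof (induction "lead w" arbitrary: w rule: wfp_induct_rule[OF wf])
    case (1 w)
    have k: "lead w \<in> I" using 1 by (simp add: lead_in)
    obtain c r where r: "w = c *s b (lead w) + r" "r \<in> below (lead w)"
      using lead_split[of w "b (lead w)"] b'[OF k] 1(2) by metis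
    have "f r \<in> below (\<tau> ?i)"
    proof (cases "r = 0")
      case False
      then have "lead r \<prec> lead w" using r(2) by (simp add: below_def)
      then show ?thesis using 1(1)[of r] False trans[OF _ 1(3)] by blast
    qed (simp add: below_def f.zero)
    moreover have "f (b (lead w)) \<in> below (\<tau> ?i)"
      using \<tau>[OF k] mono[OF k] 1 by (simp add: below_def)
    moreover have "f w = c *s f (b (lead w)) + f r"
      using arg_cong[OF r(1), of f] by (simp only: f.add f.scale)
    ultimately show ?case
      by (simp only: subspace_add subspace_scale subspace_below)
  qed
  have i: "?i \<in> I" using v by (rule lead_in)
  obtain c r where c: "c \<noteq> 0" and r: "v = c *s b ?i + r" "r \<in> below ?i"
    using lead_split[of v "b ?i"] b'[OF i] v by metis
  have fr: "f r \<in> below (\<tau> ?i)"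
    using r(2) * by (cases "r = 0") (auto simp: below_def f.zero)
  have fv: "f v = c *s f (b ?i) + f r"
    using arg_cong[OF r(1), of f] by (simp only: f.add f.scale)
  have "c *s f (b ?i) \<noteq> 0" "lead (c *s f (b ?i)) = \<tau> ?i"
    using \<tau>[OF i] c by (auto simp: lead_scale)
  then show ?thesis using lead_add_below[of "c *s f (b ?i)" "f r"] fr fv by simp
qed

text \<open>Among the vectors with leading index \<open>i\<close>, choose as \<open>x i\<close> one whose image has the least possible
  leading index.\<close>

lemma bruhat:
  assumes u: "u \<in> End scale" and v: "v \<in> End scale" and uv: "u \<circ> v = id" and vu: "v \<circ> u = id"
  obtains x \<pi> where "adapted x" "bij_betw \<pi> I I" "\<And>i. i \<in> I \<Longrightarrow> u (x i) \<noteq> 0 \<and> lead (u (x i)) = \<pi> i"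
proof -
  interpret u: Vector_Spaces.linear scale scale u using u by (simp add: End_def)
  have u0: "u w \<noteq> 0" if "w \<noteq> 0" for w
    using that vu u.zero by (metis comp_apply id_apply)
  have "\<exists>w. w \<noteq> 0 \<and> lead w = i \<and> (\<forall>w'. w' \<noteq> 0 \<longrightarrow> lead w' = i \<longrightarrow> \<not> lead (u w') \<prec> lead (u w))"
    if i: "i \<in> I" for i
  proof -
    let ?Q = "{lead (u w) | w. w \<noteq> 0 \<and> lead w = i}"
    have "?Q \<noteq> {}" using lead_onto[OF i] by auto
    then obtain z where z: "z \<in> ?Q" "\<And>y. y \<prec> z \<Longrightarrow> y \<notin> ?Q"
      using wf[unfolded wfp_iff_ex_minimal] by meson
    then show ?thesis by blast
  qed
  then obtain x where x: "\<And>i. i \<in> I \<Longrightarrow> x i \<noteq> 0 \<and> lead (x i) = i"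
    and min: "\<And>i w. i \<in> I \<Longrightarrow> w \<noteq> 0 \<Longrightarrow> lead w = i \<Longrightarrow> \<not> lead (u w) \<prec> lead (u (x i))"
    by metis
  define \<pi> where "\<pi> i = lead (u (x i))" for i
  \<comment> \<open>If the images of \<open>x i\<close> and \<open>x j\<close> had the same leading
    index, a multiple of \<open>x i\<close> could be subtracted from \<open>x j\<close>. The leading
    index \<open>j\<close> would survive while that of the image drops, against minimality.\<close>
  have neq: "\<pi> i \<noteq> \<pi> j" if i: "i \<in> I" and j: "j \<in> I" and ij: "i \<prec> j" for i j
  proof
    assume "\<pi> i = \<pi> j"
    then obtain c r where r: "u (x j) = c *s u (x i) + r" "r \<in> below (\<pi> j)"
      using lead_split[of "u (x j)" "u (x i)"] x i j u0 unfolding \<pi>_def by metis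
    have "(- c) *s x i \<in> below (lead (x j))"
      using subspace_scale[OF subspace_below, of "x i" "lead (x j)" "- c"] x i j ij
      by (simp add: below_def)
    from lead_add_below[OF _ this] have w: "x j + (- c) *s x i \<noteq> 0" "lead (x j + (- c) *s x i) = j"
      using x j by auto
    have "u (x j + (- c) *s x i) = r"
      using r(1) by (simp add: u.diff u.scale)
    then have "lead (u (x j + (- c) *s x i)) \<prec> \<pi> j"
      using r(2) u0[OF w(1)] by (auto simp: below_def)
    then show False using min[OF j w] by (simp add: \<pi>_def)
  qed
  then have inj: "inj_on \<pi> I" using total by (metis inj_onI)
  have ad: "adapted x" using x by (simp add: adapted_def)
  \<comment> \<open>A vector with leading index \<open>j\<close> lies in the image of
    \<open>u\<close>, hence in the span of the \<open>u (x i)\<close>. Their leading indices are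
    distinct, so \<open>j\<close> is one of them.\<close>
  have "j \<in> \<pi> ` I" if j: "j \<in> I" for j
  proof -
    obtain y where y: "y \<noteq> 0" "lead y = j" using lead_onto[OF j] by blast
    have "y = u (v y)" using uv by (metis comp_apply id_apply)
    moreover have "v y \<in> span (x ` I)" using adapted_basis[OF ad] by (simp add: indexed_basis_def)
    ultimately have "y \<in> span (u ` x ` I)" using u.span_image by (metis imageI)
    moreover have "0 \<notin> u ` x ` I" using u0 x by force
    moreover have "inj_on lead (u ` x ` I)"
      using inj by (auto simp: inj_on_def \<pi>_def)
    ultimately have "lead y \<in> lead ` u ` x ` I" using lead_in_span y(1) by blast
    then show ?thesis using y by (auto simp: \<pi>_def)
  qed
  moreover have "\<pi> ` I \<subseteq> I" using x u0 lead_in by (auto simp: \<pi>_def)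
  ultimately have "bij_betw \<pi> I I" using inj by (auto simp: bij_betw_def)
  then show ?thesis using that[OF ad] x u0 by (auto simp: \<pi>_def)
qed

end

section \<open>Leading indices from a well-ordered basis\<close>

lemma finite_has_maximal:
  assumes "wfP lt" and trans: "\<And>i j k. lt i j \<Longrightarrow> lt j k \<Longrightarrow> lt i k"
    and "finite S" "S \<noteq> {}"
  shows "\<exists>m\<in>S. \<forall>x\<in>S. \<not> lt m x"
proof -
  have irrefl: "\<not> lt i i" for i
    using assms(1) by (meson wfp_imp_irreflp irreflpD)
  show ?thesis
    using assms(3,4)
  proof (induction S rule: finite_ne_induct)
    case (singleton x)
    then show ?case using irrefl by blast
  next
    case (insert x F)
    then obtain m where m: "m \<in> F" "\<forall>y\<in>F. \<not> lt m y" by blast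
    show ?case
    proof (cases "lt m x")
      case True
      then have "\<forall>y\<in>insert x F. \<not> lt x y" using m trans irrefl by blast
      then show ?thesis by blast
    next
      case False
      then show ?thesis using m by blast
    qed
  qed
qed

lemma leading_index_exists:
  assumes scale: "vector_space scale" and wf: "wfP lt"
    and trans: "\<And>i j k. lt i j \<Longrightarrow> lt j k \<Longrightarrow> lt i k"
    and total: "\<And>i j. i \<noteq> j \<Longrightarrow> lt i j \<or> lt j i"
    and e: "indexed_basis scale e I"
  obtains lead where "leading_index scale lt I lead"
proof -
  interpret vector_space scale by fact
  have inj: "inj_on e I" and ind: "independent (e ` I)" and sp: "span (e ` I) = UNIV"
    using e by (auto simp: indexed_basis_def)
  define c where "c v i = representation (e ` I) v (e i)" for v i
  have c_add: "c (v + w) i = c v i + c w i" and c_scale: "c (scale a v) i = a * c v i"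
    and c_diff: "c (v - w) i = c v i - c w i" for v w a i
    using representation_add[OF ind] representation_scale[OF ind] representation_diff[OF ind] sp
    by (simp_all add: c_def)
  \<comment> \<open>\<open>P v i\<close> singles out \<open>i\<close> as the largest index in the
    support of \<open>v\<close>; it exists because supports are finite.\<close>
  define P where "P v i \<longleftrightarrow> i \<in> I \<and> c v i \<noteq> 0 \<and> (\<forall>j\<in>I. lt i j \<longrightarrow> c v j = 0)" for v i
  have P_ex: "\<exists>i. P v i" if "v \<noteq> 0" for v
  proof -
    let ?S = "{i \<in> I. c v i \<noteq> 0}"
    have "e ` ?S \<subseteq> {b. representation (e ` I) v b \<noteq> 0}" by (auto simp: c_def)
    then have "finite (e ` ?S)" using finite_representation finite_subset by blast
    moreover have "inj_on e ?S" using inj by (rule inj_on_subset) auto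
    ultimately have fin: "finite ?S" by (simp add: finite_image_iff)
    have ne: "?S \<noteq> {}"
    proof
      assume empty: "?S = {}"
      have "representation (e ` I) v b = 0" for b
        using representation_ne_zero[of "e ` I" v b] empty unfolding c_def by blast
      then show False
        using sum_nonzero_representation_eq[OF ind, of v] sp that by simp
    qed
    have "\<exists>m\<in>?S. \<forall>x\<in>?S. \<not> lt m x"
      by (rule finite_has_maximal[OF wf _ fin ne]) (fact trans)
    then show ?thesis by (auto simp: P_def)
  qed
  have P_unique: "i = j" if "P v i" "P v j" for v i j
    using that total by (metis P_def)
  define lead where "lead v = (SOME i. P v i)" for v
  have P_lead: "P v (lead v)" if "v \<noteq> 0" for v
    unfolding lead_def using P_ex[OF that] by (rule someI_ex)
  have lead_eqI: "v \<noteq> 0 \<and> lead v = i" if "P v i" for v i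
  proof -
    have "c 0 i = 0" using c_scale[of 0 0 i] by simp
    then have "v \<noteq> 0" using that by (auto simp: P_def)
    then show ?thesis using P_unique P_lead that by blast
  qed
  have "leading_index scale lt I lead"
  proof
    show "wfP lt" by fact
    show "lead v \<in> I" if "v \<noteq> 0" for v using P_lead[OF that] by (simp add: P_def)
    show "\<exists>v. v \<noteq> 0 \<and> lead v = i" if i: "i \<in> I" for i
    proof -
      have "c (e i) j = (if j = i then 1 else 0)" if "j \<in> I" for j
        using representation_basis[OF ind, of "e i"] i that inj
        by (auto simp: c_def inj_on_eq_iff)
      then have "P (e i) i"
        using i wf by (auto simp: P_def) (meson wfp_imp_irreflp irreflpD)
      then show ?thesis using lead_eqI by blast
    qed
    show "lead (scale a v) = lead v" if "v \<noteq> 0" "a \<noteq> 0" for v a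
      using P_lead[OF that(1)] that lead_eqI[of "scale a v" "lead v"] by (simp add: P_def c_scale)
    show "v + w \<noteq> 0 \<and> lead (v + w) = lead v" if "v \<noteq> 0" "w \<noteq> 0" "lt (lead w) (lead v)" for v w
    proof (rule lead_eqI)
      show "P (v + w) (lead v)"
        using P_lead[OF that(1)] P_lead[OF that(2)] that(3) trans[OF that(3)]
        by (simp add: P_def c_add)
    qed
    show "\<exists>a. v - scale a w = 0 \<or> lt (lead (v - scale a w)) (lead v)"
      if "v \<noteq> 0" "w \<noteq> 0" "lead v = lead w" for v w
    proof (intro exI disjCI)
      \<comment> \<open>The quotient of the leading coefficients kills the coordinate at
        \<open>?i\<close>. Both vectors vanish beyond \<open>?i\<close>, so nothing of the
        difference remains from there on.\<close>
      let ?i = "lead v" and ?a = "c v (lead v) / c w (lead v)"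
      let ?r = "v - scale ?a w"
      assume "\<not> lt (lead ?r) ?i"
      show "?r = 0"
      proof (rule ccontr)
        assume "?r \<noteq> 0"
        then have r: "P ?r (lead ?r)" by (rule P_lead)
        have v: "P v ?i" and w: "P w ?i" using P_lead[of v] P_lead[of w] that by auto
        have "c ?r ?i = 0" using w by (simp add: P_def c_diff c_scale)
        then have "lead ?r \<noteq> ?i" using r by (auto simp: P_def)
        then have "lt ?i (lead ?r)" using total \<open>\<not> lt (lead ?r) ?i\<close> by blast
        then have "c ?r (lead ?r) = 0" using v w r by (simp add: P_def c_diff c_scale)
        then show False using r by (simp add: P_def)
      qed
    qed
  qed (use trans total in blast)+
  then show ?thesis by (rule that)
qed

section \<open>The factorisation\<close>

text \<open>The translation by one on the integers, transported to the naturals: 0, 1, 2, ... become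
  the even numbers and -1, -2, ... the odd ones.\<close>

definition zigzag :: "nat \<Rightarrow> nat" where
  "zigzag n = (if even n then n + 2 else if n = 1 then 0 else n - 2)"

definition zigzag_inv :: "nat \<Rightarrow> nat" where
  "zigzag_inv n = (if odd n then n + 2 else if n = 0 then 1 else n - 2)"

lemma zigzag_zigzag_inv [simp]: "zigzag (zigzag_inv n) = n"
  by (simp add: zigzag_def zigzag_inv_def) presburger

lemma zigzag_inv_zigzag [simp]: "zigzag_inv (zigzag n) = n"
  by (simp add: zigzag_def zigzag_inv_def) presburger

text \<open>Even positions are those met when iterating \<open>zigzag\<close> from 0. That they are
  records of \<open>zigzag\<close> is what \<open>lead_image\<close> asks for; the next lemma serves
  the backward orbit in the same way.\<close>

lemma zigzag_less: "even n \<Longrightarrow> m < n \<Longrightarrow> zigzag m < zigzag n"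
  by (auto simp: zigzag_def)

lemma zigzag_inv_less: "odd n \<or> n = 0 \<Longrightarrow> m < n \<Longrightarrow> zigzag_inv m < zigzag_inv n"
  by (auto simp: zigzag_inv_def)

lemma four_involutions:
  assumes lead: "leading_index scale lt (L \<times> (UNIV :: nat set)) lead"
    and lt_iff: "\<And>k l m n. lt (k, m) (l, n) \<longleftrightarrow> R k l \<or> k = l \<and> m < n"
    and u: "u \<in> GL scale"
  obtains f1 f2 f3 f4 where "involution scale f1" "involution scale f2" "involution scale f3"
    "involution scale f4" "u = f1 \<circ> f2 \<circ> f3 \<circ> f4"
proof -
  interpret leading_index scale lt "L \<times> (UNIV :: nat set)" lead by fact
  let ?I = "L \<times> (UNIV :: nat set)"
  let ?\<sigma> = "apsnd zigzag :: 'c \<times> nat \<Rightarrow> 'c \<times> nat"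
  let ?\<tau> = "apsnd zigzag_inv :: 'c \<times> nat \<Rightarrow> 'c \<times> nat"
  have scale: "vector_space scale" by unfold_locales
  have bij_\<sigma>: "bij_betw ?\<sigma> ?I ?I" and bij_\<tau>: "bij_betw ?\<tau> ?I ?I"
    by (rule bij_betw_byWitness[where f' = ?\<tau>] bij_betw_byWitness[where f' = ?\<sigma>]; auto)+
  obtain v where u_End: "u \<in> End scale" and v: "v \<in> End scale" "u \<circ> v = id" "v \<circ> u = id"
    using u by (auto simp: GL_def)
  obtain x \<pi> where x: "adapted x" and \<pi>: "bij_betw \<pi> ?I ?I"
    and ux: "\<And>i. i \<in> ?I \<Longrightarrow> u (x i) \<noteq> 0 \<and> lead (u (x i)) = \<pi> i"
    using bruhat[OF u_End v] by blast
  have x': "x i \<noteq> 0" "lead (x i) = i" if "i \<in> ?I" for i using x that unfolding adapted_def by auto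
  \<comment> \<open>\<open>?\<tau>\<close> inverts \<open>?\<sigma>\<close>, so splitting off
    \<open>h\<close> from \<open>u\<close> leaves a factor whose leading indices on \<open>x\<close>
    are given by \<open>?\<sigma>\<close>.\<close>
  obtain h where h: "h \<in> End scale" "\<And>i. i \<in> ?I \<Longrightarrow> h (x i) = x ((?\<tau> \<circ> \<pi>) i)"
    using linear_extension_exists[OF scale adapted_basis[OF x], of "\<lambda>i. x ((?\<tau> \<circ> \<pi>) i)"] by blast
  have p: "bij_betw (?\<tau> \<circ> \<pi>) ?I ?I" by (rule bij_betw_trans[OF \<pi> bij_\<tau>])
  obtain f3 f4 where f34: "involution scale f3" "involution scale f4" "h = f3 \<circ> f4"
    using permuted_basis_two_involutions[where p = "?\<tau> \<circ> \<pi>", OF scale adapted_basis[OF x] h(1) p h(2)] by blast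
  have ff: "f3 (f3 y) = y" "f4 (f4 y) = y" and uv: "u (v y) = y" "v (u y) = y" for y
    using f34 v by (auto simp: involution_def dest: fun_cong)
  have End34: "f3 \<in> End scale" "f4 \<in> End scale" using f34 by (auto simp: involution_def)
  \<comment> \<open>Since \<open>h = f3 \<circ> f4\<close> with involutions, its inverse is
    \<open>f4 \<circ> f3\<close>; thus \<open>g\<close> is \<open>u\<close> times the inverse of
    \<open>h\<close>, and \<open>g'\<close> is the inverse of \<open>g\<close>.\<close>
  define g where "g = u \<circ> f4 \<circ> f3"
  define g' where "g' = f3 \<circ> f4 \<circ> v"
  have g: "g \<in> End scale" "g' \<in> End scale"
    unfolding g_def g'_def using u_End v End34 by (simp_all add: End_comp)
  have gg': "g (g' y) = y" "g' (g y) = y" for y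
    by (simp_all add: g_def g'_def ff uv)
  have gh: "g \<circ> h = u" by (simp add: g_def f34(3) fun_eq_iff ff)
  have gx: "g (x j) \<noteq> 0 \<and> lead (g (x j)) = ?\<sigma> j" if j: "j \<in> ?I" for j
  proof -
    have "j \<in> (?\<tau> \<circ> \<pi>) ` ?I" using bij_betw_imp_surj_on[OF p] j by simp
    then obtain i where i: "i \<in> ?I" "j = ?\<tau> (\<pi> i)" unfolding image_def comp_def by blast
    then have "g (x j) = u (x i)" using h(2)[OF i(1)] gh by (auto dest: fun_cong[of _ _ "x i"])
    moreover have "?\<sigma> j = \<pi> i" by (cases "\<pi> i") (simp add: i(2))
    ultimately show ?thesis using ux[OF i(1)] by simp
  qed
  have \<tau>_in: "?\<tau> j \<in> ?I" if "j \<in> ?I" for j using that by auto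
  \<comment> \<open>\<open>lead_image\<close> for \<open>g'\<close> needs an adapted family with
    known images: \<open>g'\<close> takes \<open>w j\<close> back to
    \<open>x (?\<tau> j)\<close>.\<close>
  define w where "w j = g (x (?\<tau> j))" for j
  have w: "adapted w"
    unfolding adapted_def w_def
  proof
    fix j assume j: "j \<in> ?I"
    show "g (x (?\<tau> j)) \<noteq> 0 \<and> lead (g (x (?\<tau> j))) = j"
      using gx[OF \<tau>_in[OF j]] by (cases j) simp
  qed
  have g'w: "g' (w j) \<noteq> 0 \<and> lead (g' (w j)) = ?\<tau> j" if "j \<in> ?I" for j
    using x'[OF \<tau>_in[OF that]] by (simp add: w_def gg')
  \<comment> \<open>The formula holds for every vector with such a leading index, not only for
    members of \<open>x\<close>, so it can be iterated. In the lexicographic order, smaller indices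
    in other copies stay smaller because \<open>?\<sigma>\<close> fixes the first component.\<close>
  have lead_g: "g y \<noteq> 0 \<and> lead (g y) = (l, n + 2)" if "y \<noteq> 0" "lead y = (l, n)" "even n" for y l n
  proof -
    have "g y \<noteq> 0 \<and> lead (g y) = ?\<sigma> (lead y)"
      by (rule lead_image[OF g(1) x gx that(1)])
        (use that zigzag_less in \<open>auto simp: lt_iff\<close>)
    then show ?thesis using that by (simp add: zigzag_def)
  qed
  have lead_g': "g' y \<noteq> 0 \<and> lead (g' y) = (l, zigzag_inv n)"
    if "y \<noteq> 0" "lead y = (l, n)" "odd n \<or> n = 0" for y l n
  proof -
    have "g' y \<noteq> 0 \<and> lead (g' y) = ?\<tau> (lead y)"
      by (rule lead_image[OF g(2) w g'w that(1)])
        (use that zigzag_inv_less in \<open>auto simp: lt_iff\<close>)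
    then show ?thesis using that by simp
  qed
  \<comment> \<open>Nonnegative powers of \<open>g\<close> fill the even positions and negative
    powers the odd ones. The \<open>Suc\<close> places the inverse power -1 at position 1, since
    power 0 already occupies position 0.\<close>
  define z where "z i = (let n = snd i in
    (if even n then g ^^ (n div 2) else g' ^^ Suc (n div 2)) (x (fst i, 0)))" for i
  have z_even: "(g ^^ k) (x (l, 0)) \<noteq> 0 \<and> lead ((g ^^ k) (x (l, 0))) = (l, 2 * k)" if "l \<in> L" for l k
    by (induction k) (use that x' lead_g in \<open>auto\<close>)
  have z_odd: "(g' ^^ Suc k) (x (l, 0)) \<noteq> 0 \<and> lead ((g' ^^ Suc k) (x (l, 0))) = (l, 2 * k + 1)"
    if "l \<in> L" for l k
  proof (induction k)
    case 0
    then show ?case using lead_g'[of "x (l, 0)" l 0] x'[of "(l, 0)"] that by (simp add: zigzag_inv_def)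
  next
    case (Suc k)
    then show ?case
      using lead_g'[of "(g' ^^ Suc k) (x (l, 0))" l "2 * k + 1"] by (simp add: zigzag_inv_def)
  qed
  have z: "adapted z"
    unfolding adapted_def
  proof
    fix i assume "i \<in> ?I"
    then obtain l n where i: "i = (l, n)" "l \<in> L" by auto
    show "z i \<noteq> 0 \<and> lead (z i) = i"
    proof (cases "even n")
      case True
      then show ?thesis using z_even[OF i(2), of "n div 2"] by (simp add: z_def i)
    next
      case False
      then show ?thesis using z_odd[OF i(2), of "n div 2"] by (simp add: z_def i)
    qed
  qed
  have gz: "g (z i) = z (?\<sigma> i)" if "i \<in> ?I" for i
  proof -
    obtain l n where i: "i = (l, n)" by (cases i)
    \<comment> \<open>Applying \<open>g\<close> adds a forward power, returns from position 1 to the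
      start, or cancels one of several backward powers.\<close>
    consider k where "n = 2 * k" | "n = 1" | k where "n = 2 * Suc k + 1"
    proof (cases "even n")
      case False
      then obtain k where "n = 2 * k + 1" by (rule oddE)
      then show ?thesis using that(2,3) by (cases k) auto
    qed (auto elim: evenE intro: that(1))
    then show ?thesis
    proof cases
      case 1
      then show ?thesis by (simp add: i z_def zigzag_def)
    next
      case 2
      then show ?thesis by (simp add: i z_def zigzag_def gg')
    next
      case 3
      then show ?thesis by (simp add: i z_def zigzag_def gg')
    qed
  qed
  obtain f1 f2 where "involution scale f1" "involution scale f2" "g = f1 \<circ> f2"
    using permuted_basis_two_involutions[where p = ?\<sigma>, OF scale adapted_basis[OF z] g(1) bij_\<sigma> gz] by blast
  then show ?thesis
    using that f34 gh by (simp add: comp_assoc)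
qed

section \<open>Choice of the index set and conclusion\<close>

text \<open>Cardinal arithmetic: an infinite cardinal absorbs a countable factor. This splits a
  basis into countable blocks, on each of which the zigzag acts.\<close>

lemma infinite_bij_betw_Times_nat:
  assumes "infinite B"
  obtains e where "bij_betw e (B \<times> (UNIV :: nat set)) B"
proof -
  include cardinal_syntax
  have "|UNIV :: nat set| \<le>o |B|" using assms by (simp only: infinite_iff_card_of_nat)
  from card_of_Times_infinite[OF assms UNIV_not_empty this]
  have "|B \<times> (UNIV :: nat set)| =o |B|" by (rule conjunct1)
  then show ?thesis
    unfolding card_of_ordIso[symmetric] using that by (elim exE)
qed

theorem theorem1p1:
  fixes scale :: "'a::field \<Rightarrow> 'b::ab_group_add \<Rightarrow> 'b"
  assumes "vector_space scale"
    and "infinite_dimensional scale"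
  shows "\<forall>u \<in> GL scale. \<exists>a\<^sub>1 a\<^sub>2 a\<^sub>3 a\<^sub>4.
           involution scale a\<^sub>1 \<and> involution scale a\<^sub>2 \<and>
           involution scale a\<^sub>3 \<and> involution scale a\<^sub>4 \<and>
           u = a\<^sub>1 \<circ> a\<^sub>2 \<circ> a\<^sub>3 \<circ> a\<^sub>4"
proof
  fix u assume u: "u \<in> GL scale"
  interpret vector_space scale by fact
  obtain B where "B \<subseteq> UNIV" and B: "independent B" "UNIV \<subseteq> span B"
    by (rule maximal_independent_subset)
  then have sp: "span B = UNIV" by auto
  have inf: "infinite B"
    using assms(2) B(1) sp unfolding infinite_dimensional_def by metis
  then obtain e where "bij_betw e (B \<times> (UNIV :: nat set)) B"
    by (rule infinite_bij_betw_Times_nat)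
  then have e: "indexed_basis scale e (B \<times> (UNIV :: nat set))"
    unfolding indexed_basis_def bij_betw_def using B(1) sp by simp
  obtain r :: "'b rel" where r: "Well_order r" "Field r = UNIV"
    using well_ordering by (elim exE conjE)
  then have r': "trans r" "antisym r" "total_on UNIV r" "wf (r - Id)"
    unfolding well_order_on_def linear_order_on_def partial_order_on_def preorder_on_def by simp_all
  define R where "R = r - Id"
  have wfR: "wf R" using r' by (simp add: R_def)
  have totalR: "(k, l) \<in> R \<or> (l, k) \<in> R" if "k \<noteq> l" for k l
    using r'(3) that by (simp add: R_def total_on_def)
  have transR: "(k, m) \<in> R" if "(k, l) \<in> R" "(l, m) \<in> R" for k l m
    using that r'(1,2) unfolding R_def by (blast dest: transD antisymD)
  \<comment> \<open>The block is compared first and the position inside it second, so each block is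
    an interval ordered like the naturals.\<close>
  define lt where "lt i j \<longleftrightarrow> (i, j) \<in> R <*lex*> less_than" for i j :: "'b \<times> nat"
  have lt_iff: "lt (k, m) (l, n) \<longleftrightarrow> (k, l) \<in> R \<or> k = l \<and> m < n" for k l m n
    by (simp add: lt_def)
  obtain lead where lead: "leading_index scale lt (B \<times> (UNIV :: nat set)) lead"
  proof (rule leading_index_exists[OF assms(1) _ _ _ e, of lt])
    show "wfP lt"
      using wf_lex_prod[OF wfR wf_less_than] by (simp add: lt_def[abs_def] wfp_def)
    show "lt i k" if "lt i j" "lt j k" for i j k
      using that by (cases i; cases j; cases k) (auto simp: lt_iff intro: transR)
    show "lt i j \<or> lt j i" if "i \<noteq> j" for i j
      using that totalR by (cases i; cases j) (auto simp: lt_iff)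
  qed
  show "\<exists>a\<^sub>1 a\<^sub>2 a\<^sub>3 a\<^sub>4. involution scale a\<^sub>1 \<and> involution scale a\<^sub>2 \<and>
      involution scale a\<^sub>3 \<and> involution scale a\<^sub>4 \<and> u = a\<^sub>1 \<circ> a\<^sub>2 \<circ> a\<^sub>3 \<circ> a\<^sub>4"
    by (rule four_involutions[OF lead lt_iff u]) (intro exI conjI)
qed

end
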